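(* Let $(X,d)$ be a compact metric space and let $f:X\to X$ be a continuous map such that $(X,d,f)$ has the specification property. Let $z_0\in X$ be a non-transitive point, i.e. $\overline{O_f(z_0)}\neq X$. Then either $E(z_0)=\emptyset$, or both of the following equalities hold: $$\overline{\mathrm{mdim}}_M^B(E(z_0),f,d)=\overline{\mathrm{mdim}}_M(X,f,d)\quad\text{and}\quad \underline{\mathrm{mdim}}_M^B(E(z_0),f,d)=\underline{\mathrm{mdim}}_M(X,f,d).$$
   Context: $O_f(x)=\{x,f(x),f^2(x),\dots\}$ is the forward orbit of $x$, and for $z_0\in X$, $$E(z_0)=\{x\in X: z_0\notin\overline{\{f^n(x):n\ge 0\}}\}.$$ Specification property: for any $\epsilon>0$ there is an integer $m=m(\epsilon)$ such that for any finite collection of intervals $I_j=[a_j,b_j]$, $j=1,\dots,k$ (with nonnegative integer endpoints $a_j\le b_j$) satisfying $a_{j+1}-b_j\ge m$ for $j=1,\dots,k-1$, and any $x_1,\dots,x_k\in X$, there is a point $x\in X$ with $d(f^{p+a_j}(x),f^p(x_j))<\epsilon$ for all $p=0,1,\dots,b_j-a_j$ and every $j=1,\dots,k$. Bowen metrics: for $n\in\mathbb{N}$, $d_n(x,y)=\max\{d(f^i(x),f^i(y)):0\le i\le n-1\}$ and $B_n(x,\epsilon)=\{y\in X:d_n(x,y)<\epsilon\}$. Bowen metric mean dimension: for $Z\subseteq X$, $\epsilon>0$, $N\in\mathbb{N}$, $\lambda\in\mathbb{R}$, let $$m(Z,\lambda,N,\epsilon)=\inf_{\Gamma}\sum_{i\in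 I}\exp(-\lambda n_i),$$ the infimum being over all finite or countable collections $\Gamma=\{B_{n_i}(x_i,\epsilon)\}_{i\in I}$ with $Z\subseteq\bigcup_{i\in I}B_{n_i}(x_i,\epsilon)$ and $\min\{n_i:i\in I\}\ge N$. Let $m(Z,\lambda,\epsilon)=\lim_{N\to\infty}m(Z,\lambda,N,\epsilon)$ (a nondecreasing limit in $N$), and $$h^B_{top}(Z,f,\epsilon)=\inf\{\lambda\in\mathbb{R}:m(Z,\lambda,\epsilon)=0\}=\sup\{\lambda\in\mathbb{R}:m(Z,\lambda,\epsilon)=\infty\}.$$ The Bowen upper and lower metric mean dimensions of $f$ on $Z$ are $$\overline{\mathrm{mdim}}^B_M(Z,f,d)=\limsup_{\epsilon\to0}\frac{h^B_{top}(Z,f,\epsilon)}{|\log\epsilon|},\qquad \underline{\mathrm{mdim}}^B_M(Z,f,d)=\liminf_{\epsilon\to0}\frac{h^B_{top}(Z,f,\epsilon)}{|\log\epsilon|}.$$ Classical metric mean dimension: a set $E\subset X$ is $(n,\epsilon)$-separated if $d_n(x,y)>\epsilon$ for all distinct $x,y\in E$; $s(f,X,n,\epsilon)$ is the largest cardinality of an $(n,\epsilon)$-separated subset of $X$. Then $$\overline{\mathrm{mdim}}_M(X,f,d)=\limsup_{\epsilon\to0}\frac{\limsup_{n\to\infty}\frac1n\log s(f,X,n,\epsilon)}{|\log\epsilon|},\qquad \underline{\mathrm{mdim}}_M(X,f,d)=\liminf_{\epsilon\to0}\frac{\limsup_{n\to\infty}\frac1n\log s(f,X,n,\epsilon)}{|\log\epsilon|}.$$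 These quantities may equal $+\infty$. *)

theory Defs
  imports "HOL-Analysis.Analysis"
begin

text \<open>The space \<open>X\<close> is the universe of a type of class \<^class>\<open>metric_space\<close>.\<close>

definition forward_orbit :: "('a \<Rightarrow> 'a) \<Rightarrow> 'a \<Rightarrow> 'a set" where
  "forward_orbit f x = {(f ^^ n) x | n. True}"

definition nonaccumulating_set :: "('a::topological_space \<Rightarrow> 'a) \<Rightarrow> 'a \<Rightarrow> 'a set" where
  "nonaccumulating_set f z0 = {x. z0 \<notin> closure (forward_orbit f x)}"

definition specification_property :: "('a::metric_space \<Rightarrow> 'a) \<Rightarrow> bool" where
  "specification_property f \<longleftrightarrow>
    (\<forall>\<epsilon>>0. \<exists>m::int. \<forall>(k::nat) (a::nat \<Rightarrow> nat) (b::nat \<Rightarrow> nat) (xs::nat \<Rightarrow> 'a).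
      (\<forall>j\<in>{1..k}. a j \<le> b j) \<longrightarrow>
      (\<forall>j\<in>{1..<k}. int (a (j + 1)) - int (b j) \<ge> m) \<longrightarrow>
      (\<exists>x. \<forall>j\<in>{1..k}. \<forall>p\<in>{0..b j - a j}.
         dist ((f ^^ (p + a j)) x) ((f ^^ p) (xs j)) < \<epsilon>))"

text \<open>Only \<open>n \<ge> 1\<close> is meaningful below; by truncated subtraction, \<open>n = 0\<close> gives the same
  metric as \<open>n = 1\<close>, which affects none of the limits.\<close>

definition bowen_dist :: "('a::metric_space \<Rightarrow> 'a) \<Rightarrow> nat \<Rightarrow> 'a \<Rightarrow> 'a \<Rightarrow> real" where
  "bowen_dist f n x y = Max ((\<lambda>i. dist ((f ^^ i) x) ((f ^^ i) y)) ` {0..n - 1})"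

definition bowen_ball :: "('a::metric_space \<Rightarrow> 'a) \<Rightarrow> nat \<Rightarrow> 'a \<Rightarrow> real \<Rightarrow> 'a set" where
  "bowen_ball f n x \<epsilon> = {y. bowen_dist f n x y < \<epsilon>}"

text \<open>Finite or countable covers by Bowen balls are families indexed by a set \<open>I\<close> of naturals.\<close>

definition bowen_premeasure ::
    "('a::metric_space \<Rightarrow> 'a) \<Rightarrow> 'a set \<Rightarrow> real \<Rightarrow> nat \<Rightarrow> real \<Rightarrow> ennreal" where
  "bowen_premeasure f Z lam N \<epsilon> =
    Inf {(\<Sum>\<^sub>\<infinity>i\<in>I. ennreal (exp (- lam * real (n i)))) |
           (I::nat set) (n::nat \<Rightarrow> nat) (x::nat \<Rightarrow> 'a).
           Z \<subseteq> (\<Union>i\<in>I. bowen_ball f (n i) (x i) \<epsilon>) \<and> (\<forall>i\<in>I. n i \<ge> N)}"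

definition bowen_measure ::
    "('a::metric_space \<Rightarrow> 'a) \<Rightarrow> 'a set \<Rightarrow> real \<Rightarrow> real \<Rightarrow> ennreal" where
  "bowen_measure f Z lam \<epsilon> = lim (\<lambda>N. bowen_premeasure f Z lam N \<epsilon>)"

definition bowen_entropy :: "('a::metric_space \<Rightarrow> 'a) \<Rightarrow> 'a set \<Rightarrow> real \<Rightarrow> ereal" where
  "bowen_entropy f Z \<epsilon> = Inf {ereal lam | lam. bowen_measure f Z lam \<epsilon> = 0}"

definition upper_bowen_mdim :: "('a::metric_space \<Rightarrow> 'a) \<Rightarrow> 'a set \<Rightarrow> ereal" where
  "upper_bowen_mdim f Z = Limsup (at_right 0) (\<lambda>\<epsilon>. bowen_entropy f Z \<epsilon> / ereal \<bar>ln \<epsilon>\<bar>)"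

definition lower_bowen_mdim :: "('a::metric_space \<Rightarrow> 'a) \<Rightarrow> 'a set \<Rightarrow> ereal" where
  "lower_bowen_mdim f Z = Liminf (at_right 0) (\<lambda>\<epsilon>. bowen_entropy f Z \<epsilon> / ereal \<bar>ln \<epsilon>\<bar>)"

definition dyn_separated :: "('a::metric_space \<Rightarrow> 'a) \<Rightarrow> nat \<Rightarrow> real \<Rightarrow> 'a set \<Rightarrow> bool" where
  "dyn_separated f n \<epsilon> E \<longleftrightarrow> (\<forall>x\<in>E. \<forall>y\<in>E. x \<noteq> y \<longrightarrow> bowen_dist f n x y > \<epsilon>)"

text \<open>For continuous \<open>f\<close> on a compact space and \<open>\<epsilon> > 0\<close>, separated sets are finite with bounded
  cardinality, so the maximum exists.\<close>

definition max_separated :: "('a::metric_space \<Rightarrow> 'a) \<Rightarrow> 'a set \<Rightarrow> nat \<Rightarrow> real \<Rightarrow> nat" where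
  "max_separated f Z n \<epsilon> = Max {card E | E. E \<subseteq> Z \<and> finite E \<and> dyn_separated f n \<epsilon> E}"

definition separated_growth :: "('a::metric_space \<Rightarrow> 'a) \<Rightarrow> 'a set \<Rightarrow> real \<Rightarrow> ereal" where
  "separated_growth f Z \<epsilon> = limsup (\<lambda>n. ereal (1 / real n * ln (real (max_separated f Z n \<epsilon>))))"

definition upper_mdim :: "('a::metric_space \<Rightarrow> 'a) \<Rightarrow> 'a set \<Rightarrow> ereal" where
  "upper_mdim f Z = Limsup (at_right 0) (\<lambda>\<epsilon>. separated_growth f Z \<epsilon> / ereal \<bar>ln \<epsilon>\<bar>)"

definition lower_mdim :: "('a::metric_space \<Rightarrow> 'a) \<Rightarrow> 'a set \<Rightarrow> ereal" where
  "lower_mdim f Z = Liminf (at_right 0) (\<lambda>\<epsilon>. separated_growth f Z \<epsilon> / ereal \<bar>ln \<epsilon>\<bar>)"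

end

theory Submission
  imports Defs "HOL-Real_Asymp.Real_Asymp"
begin

text \<open>At every resolution \<open>e > 0\<close> the Bowen entropy \<open>h e\<close> of \<open>nonaccumulating_set f z0\<close> is
  sandwiched between separated growth rates of the whole space at proportional resolutions,
  \<open>g (4 * e) \<le> h e \<le> g (e / 2)\<close>. Since \<open>ln (c * e) / ln e\<close> tends to \<open>1\<close> as \<open>e\<close> tends to \<open>0\<close>,
  dividing by \<open>\<bar>ln e\<bar>\<close> and passing to the upper or lower limit makes the two outer terms
  agree (\<open>log_rate_mono_rescale\<close>).

  The upper bound (\<open>bowen_entropy_le_separated_growth\<close>) holds for every subset: a maximal
  \<open>(n, e/2)\<close>-separated set is the set of centres of a cover by Bowen balls of order \<open>n\<close> and
  radius \<open>e\<close>.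

  The lower bound (\<open>separated_growth_le_bowen_entropy\<close>) needs many points whose orbits stay away
  from \<open>z0\<close>. As \<open>z0\<close> is not transitive, its orbit misses a ball around some \<open>c\<close>. If the orbit of
  \<open>x\<close> comes close to \<open>c\<close> with bounded gaps, it can never come very close to \<open>z0\<close>, since it would then
  follow the orbit of \<open>z0\<close> for so long that it misses a visit to \<open>c\<close>
  (\<open>nonaccumulating_if_syndetic_visits\<close>). Specification provides points that shadow an
  arbitrary sequence of orbit segments, taken from a maximal \<open>(n, 4 * e)\<close>-separated set \<open>E\<close>, and
  that visit \<open>c\<close> after each segment. They form a compact set on which the choice of the segments
  is free, one choice per \<open>T\<close> steps, where \<open>T - n\<close> does not depend on \<open>n\<close>. A Kraft-type count of
  finite words (\<open>cylinder_cover_weight_ge_1\<close>) then shows directly, without constructing a measure, that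
  the entropy of this set is at least \<open>ln (card E) / T\<close>
  (\<open>bowen_entropy_ge_of_free_itineraries\<close>), and for suitable large \<open>n\<close> this is close to
  \<open>g (4 * e)\<close>, or arbitrarily large if \<open>g (4 * e)\<close> is infinite.\<close>

section \<open>Bowen metrics and Bowen balls\<close>

lemma bowen_dist_less_iff:
  "bowen_dist f n x y < e \<longleftrightarrow> (\<forall>i\<le>n - 1. dist ((f ^^ i) x) ((f ^^ i) y) < e)"
  unfolding bowen_dist_def by (subst Max_less_iff) auto

lemma less_bowen_dist_iff:
  "e < bowen_dist f n x y \<longleftrightarrow> (\<exists>i\<le>n - 1. e < dist ((f ^^ i) x) ((f ^^ i) y))"
  unfolding bowen_dist_def by (subst Max_gr_iff) auto

lemma bowen_dist_self [simp]: "bowen_dist f n x x = 0"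
  unfolding bowen_dist_def by (simp add: image_constant_conv)

lemma bowen_dist_commute: "bowen_dist f n x y = bowen_dist f n y x"
  unfolding bowen_dist_def by (simp add: dist_commute)

lemma continuous_on_funpow:
  fixes f :: "'a::topological_space \<Rightarrow> 'a"
  assumes "continuous_on UNIV f"
  shows "continuous_on UNIV (f ^^ n)"
proof (induction n)
  case (Suc n)
  have "continuous_on UNIV (f \<circ> (f ^^ n))"
    by (rule continuous_on_compose[OF Suc]) (rule continuous_on_subset[OF assms], simp)
  then show ?case by (simp add: comp_def)
qed simp

lemma open_bowen_ball:
  assumes "continuous_on UNIV f"
  shows "open (bowen_ball f n x e)"
proof -
  have "bowen_ball f n x e = (\<Inter>i\<in>{..n - 1}. {y. dist ((f ^^ i) x) ((f ^^ i) y) < e})"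
    by (auto simp: bowen_ball_def bowen_dist_less_iff)
  also have "open \<dots>"
    by (intro open_INT ballI finite_atMost open_Collect_less continuous_intros
        continuous_on_funpow[OF assms])
  finally show ?thesis .
qed

lemma closed_shadowing:
  fixes f :: "'a::metric_space \<Rightarrow> 'a"
  assumes "continuous_on UNIV f"
  shows "closed {x. dist ((f ^^ q) x) c \<le> e}"
  by (intro closed_Collect_le continuous_intros continuous_on_funpow[OF assms])

section \<open>Maximal separated sets\<close>

text \<open>A finite cover by Bowen balls of radius \<open>e/2\<close> bounds every \<open>(n, e)\<close>-separated set, since
  each of these balls contains at most one of its points.\<close>

lemma dyn_separated_card_bounded:
  fixes f :: "'a::metric_space \<Rightarrow> 'a"
  assumes "compact (UNIV::'a set)" and cont: "continuous_on UNIV f" and e: "0 < e"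
  shows "\<exists>B. \<forall>E. dyn_separated f n e E \<longrightarrow> card E \<le> B"
proof -
  have "x \<in> bowen_ball f n x (e/2)" for x
    using e by (simp add: bowen_ball_def)
  then have "UNIV \<subseteq> (\<Union>x\<in>UNIV. bowen_ball f n x (e/2))" by blast
  then obtain C where C: "finite C" "UNIV \<subseteq> (\<Union>x\<in>C. bowen_ball f n x (e/2))"
    using compactE_image[OF assms(1), of UNIV "\<lambda>x. bowen_ball f n x (e/2)"]
      open_bowen_ball[OF cont] by metis
  have "\<forall>y. \<exists>c. c \<in> C \<and> y \<in> bowen_ball f n c (e/2)"
    using C(2) by auto
  then obtain g where g: "\<And>y. g y \<in> C" "\<And>y. y \<in> bowen_ball f n (g y) (e/2)"
    by metis
  have "card E \<le> card C" if "dyn_separated f n e E" for E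
  proof (rule card_inj_on_le[of g])
    show "inj_on g E"
    proof (rule inj_onI, rule ccontr)
      fix x y assume xy: "x \<in> E" "y \<in> E" "g x = g y" "x \<noteq> y"
      have "e < bowen_dist f n x y"
        using that xy by (simp add: dyn_separated_def)
      then obtain i where i: "i \<le> n - 1" "e < dist ((f ^^ i) x) ((f ^^ i) y)"
        unfolding less_bowen_dist_iff by blast
      have "dist ((f ^^ i) (g x)) ((f ^^ i) x) < e/2" "dist ((f ^^ i) (g x)) ((f ^^ i) y) < e/2"
        using g(2)[of x, unfolded bowen_ball_def mem_Collect_eq bowen_dist_less_iff]
          g(2)[of y, unfolded bowen_ball_def mem_Collect_eq bowen_dist_less_iff] i(1) xy(3) by simp_all
      then show False
        using i(2) dist_triangle3[of "(f ^^ i) x" "(f ^^ i) y" "(f ^^ i) (g x)"] by linarith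
    qed
  qed (use g C in auto)
  then show ?thesis by blast
qed

text \<open>Separated sets of maximal cardinality are also spanning: a point that no element of the set
  comes \<open>e\<close>-close to could be added to it.\<close>

lemma max_separated_spanning:
  fixes f :: "'a::metric_space \<Rightarrow> 'a"
  assumes "compact (UNIV::'a set)" and "continuous_on UNIV f" and "0 < e"
  obtains E where "finite E" "E \<noteq> {}" "dyn_separated f n e E"
    "card E = max_separated f UNIV n e" "\<And>y. \<exists>x\<in>E. bowen_dist f n x y \<le> e"
proof -
  obtain B where B: "\<And>E. dyn_separated f n e E \<Longrightarrow> card E \<le> B"
    using dyn_separated_card_bounded[OF assms] by blast
  let ?S = "{card E | E. E \<subseteq> UNIV \<and> finite E \<and> dyn_separated f n e E}"
  have fin: "finite ?S"
    by (rule finite_subset[of _ "{..B}"]) (use B in auto)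
  have "card {} \<in> ?S"
    by (force simp: dyn_separated_def)
  then have "Max ?S \<in> ?S"
    using fin by (intro Max_in) auto
  then obtain E where E: "finite E" "dyn_separated f n e E" "card E = Max ?S"
    by auto
  have maxE: "card F \<le> card E" if "finite F" "dyn_separated f n e F" for F
    unfolding E(3) using that by (intro Max_ge fin) auto
  have "\<exists>x\<in>E. bowen_dist f n x y \<le> e" for y
  proof (cases "y \<in> E")
    case True
    then show ?thesis using assms(3) by (intro bexI[of _ y]) auto
  next
    case False
    show ?thesis
    proof (rule ccontr)
      assume "\<not> ?thesis"
      then have "dyn_separated f n e (insert y E)"
        using E(2) by (auto simp: dyn_separated_def not_le bowen_dist_commute)
      then have "card (insert y E) \<le> card E"
        using E(1) maxE by auto
      then show False using False E(1) by simp
    qed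
  qed
  moreover from this have "E \<noteq> {}" by blast
  ultimately show ?thesis
    using that[of E] E by (simp add: max_separated_def)
qed

section \<open>The Bowen outer measure\<close>

lemma bowen_measure_eq_SUP:
  "bowen_measure f Z lam e = (SUP N. bowen_premeasure f Z lam N e)"
proof -
  have "incseq (\<lambda>N. bowen_premeasure f Z lam N e)"
    unfolding incseq_def bowen_premeasure_def
    by (intro allI impI Inf_superset_mono) force
  then show ?thesis
    unfolding bowen_measure_def by (intro limI LIMSEQ_SUP)
qed

lemma bowen_premeasure_le_cover:
  assumes E: "finite E" "\<And>y. y \<in> Z \<Longrightarrow> \<exists>x\<in>E. y \<in> bowen_ball f n x e" and n: "N \<le> n"
  shows "bowen_premeasure f Z lam N e \<le> ennreal (real (card E) * exp (- lam * real n))"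
proof -
  obtain h where h: "bij_betw h {0..<card E} E"
    using ex_bij_betw_nat_finite[OF E(1)] by blast
  have "Z \<subseteq> (\<Union>i\<in>{0..<card E}. bowen_ball f n (h i) e)"
  proof
    fix y assume "y \<in> Z"
    then obtain x where x: "x \<in> E" "y \<in> bowen_ball f n x e" using E(2) by blast
    then obtain i where "i \<in> {0..<card E}" "x = h i"
      using bij_betw_imp_surj_on[OF h] by blast
    then show "y \<in> (\<Union>i\<in>{0..<card E}. bowen_ball f n (h i) e)" using x(2) by blast
  qed
  then have "bowen_premeasure f Z lam N e
      \<le> (\<Sum>\<^sub>\<infinity>i\<in>{0..<card E}. ennreal (exp (- lam * real n)))"
    unfolding bowen_premeasure_def
    by (intro Inf_lower CollectI exI[of _ "{0..<card E}"] exI[of _ "\<lambda>_. n"] exI[of _ h]) (simp add: n)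
  also have "\<dots> = ennreal (real (card E) * exp (- lam * real n))"
    by (simp add: ennreal_mult ennreal_of_nat_eq_real_of_nat)
  finally show ?thesis .
qed

text \<open>Maximal \<open>(n, e')\<close>-separated sets are centres of a cover by roughly at most \<open>exp (n g)\<close> Bowen balls of
  order \<open>n\<close>, where \<open>g\<close> is the growth rate; for \<open>lam > g\<close> the weight of this cover tends to \<open>0\<close>.\<close>

lemma bowen_entropy_le_separated_growth:
  fixes f :: "'a::metric_space \<Rightarrow> 'a"
  assumes "compact (UNIV::'a set)" and "continuous_on UNIV f" and "0 < e'" and "e' < e"
  shows "bowen_entropy f Z e \<le> separated_growth f UNIV e'"
proof (rule ccontr)
  assume "\<not> ?thesis"
  then obtain lam where lam: "separated_growth f UNIV e' < ereal lam" "ereal lam < bowen_entropy f Z e"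
    using ereal_dense2 by (force simp: not_le)
  obtain mu where mu: "separated_growth f UNIV e' < ereal mu" "mu < lam"
    using ereal_dense2[OF lam(1)] by auto
  have ev: "eventually (\<lambda>n. ereal (1 / real n * ln (real (max_separated f UNIV n e'))) < ereal mu) sequentially"
    using mu(1) unfolding separated_growth_def by (rule Limsup_lessD)
  have "bowen_premeasure f Z lam N e = 0" for N
  proof -
    have "eventually (\<lambda>n. bowen_premeasure f Z lam N e \<le> ennreal (exp (- (lam - mu) * real n))) sequentially"
      using ev eventually_ge_at_top[of "max N 1"]
    proof eventually_elim
      case (elim n)
      obtain E where E: "finite E" "E \<noteq> {}" "card E = max_separated f UNIV n e'"
        "\<And>y. \<exists>x\<in>E. bowen_dist f n x y \<le> e'"
        using max_separated_spanning[OF assms(1-3), of n] by metis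
      have "ln (real (card E)) \<le> mu * real n"
        using elim E(3) by (simp add: field_simps)
      then have "real (card E) \<le> exp (mu * real n)"
        using E(1,2) by (metis card_gt_0_iff exp_le_cancel_iff exp_ln of_nat_0_less_iff)
      then have "real (card E) * exp (- lam * real n) \<le> exp (- (lam - mu) * real n)"
        by (simp add: left_diff_distrib exp_diff exp_minus divide_inverse mult_right_mono)
      moreover have "bowen_premeasure f Z lam N e \<le> ennreal (real (card E) * exp (- lam * real n))"
      proof (rule bowen_premeasure_le_cover[OF E(1)])
        show "\<exists>x\<in>E. y \<in> bowen_ball f n x e" for y
          using E(4)[of y] assms(4) unfolding bowen_ball_def by (meson le_less_trans mem_Collect_eq)
      qed (use elim in simp)
      ultimately show ?case
        using ennreal_leI order_trans by blast
    qed
    moreover have "(\<lambda>n. ennreal (exp (- (lam - mu) * real n))) \<longlonglongrightarrow> ennreal 0"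
    proof (rule tendsto_ennrealI)
      have "filterlim (\<lambda>n. - (lam - mu) * real n) at_bot sequentially"
        using mu(2) by (intro filterlim_tendsto_neg_mult_at_bot[OF tendsto_const])
          (auto intro: filterlim_real_sequentially)
      then show "(\<lambda>n. exp (- (lam - mu) * real n)) \<longlonglongrightarrow> 0"
        by (rule filterlim_compose[OF exp_at_bot])
    qed
    ultimately have "bowen_premeasure f Z lam N e \<le> ennreal 0"
      using tendsto_lowerbound sequentially_bot by blast
    then show ?thesis by simp
  qed
  then have "bowen_measure f Z lam e = 0"
    by (simp add: bowen_measure_eq_SUP)
  then have "bowen_entropy f Z e \<le> ereal lam"
    unfolding bowen_entropy_def by (intro Inf_lower) auto
  then show False using lam(2) by simp
qed

section \<open>Lower bounds for Bowen entropy by counting itineraries\<close>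

text \<open>A form of the Kraft inequality. Each \<open>W i\<close> lies in a cylinder of length \<open>k i\<close>, so it contains
  at most the fraction \<open>(card E) ^ (- k i)\<close> of all words of length \<open>K\<close>.\<close>

lemma cylinder_cover_weight_ge_1:
  fixes k :: "'i \<Rightarrow> nat"
  assumes E: "finite E" "E \<noteq> {}" and J: "finite J" and kK: "\<And>i. i \<in> J \<Longrightarrow> k i \<le> K"
    and cover: "PiE {..<K} (\<lambda>_. E) \<subseteq> (\<Union>i\<in>J. W i)"
    and cyl: "\<And>i u v q. \<lbrakk>i \<in> J; u \<in> W i; v \<in> W i; u \<in> PiE {..<K} (\<lambda>_. E); v \<in> PiE {..<K} (\<lambda>_. E);
      q < k i\<rbrakk> \<Longrightarrow> u q = v q"
  shows "1 \<le> (\<Sum>i\<in>J. 1 / real (card E) ^ k i)"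
proof -
  let ?P = "PiE {..<K} (\<lambda>_. E)" and ?M = "real (card E)"
  have M: "0 < ?M" using E by (simp add: card_gt_0_iff)
  have card_piece: "card (?P \<inter> W i) \<le> card E ^ (K - k i)" if i: "i \<in> J" for i
  proof -
    have "card (?P \<inter> W i) \<le> card (PiE {k i..<K} (\<lambda>_. E))"
    proof (rule card_inj_on_le[of "\<lambda>u. restrict u {k i..<K}"])
      show "inj_on (\<lambda>u. restrict u {k i..<K}) (?P \<inter> W i)"
      proof (rule inj_onI)
        fix u v assume uv: "u \<in> ?P \<inter> W i" "v \<in> ?P \<inter> W i"
          "restrict u {k i..<K} = restrict v {k i..<K}"
        have "u q = v q" if "q < K" for q
        proof (cases "q < k i")
          case True
          then show ?thesis using cyl[OF i] uv by blast
        next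
          case False
          then show ?thesis using fun_cong[OF uv(3), of q] that by simp
        qed
        then show "u = v" using uv(1,2) by (intro PiE_ext[of u "{..<K}"]) auto
      qed
      show "(\<lambda>u. restrict u {k i..<K}) ` (?P \<inter> W i) \<subseteq> PiE {k i..<K} (\<lambda>_. E)"
      proof (rule image_subsetI)
        fix u assume "u \<in> ?P \<inter> W i"
        then have "u q \<in> E" if "q < K" for q using that by auto
        then show "restrict u {k i..<K} \<in> PiE {k i..<K} (\<lambda>_. E)" by (intro restrict_PiE_iff[THEN iffD2]) simp
      qed
      show "finite (PiE {k i..<K} (\<lambda>_. E))"
        using E(1) by (intro finite_PiE) auto
    qed
    then show ?thesis by (simp add: card_PiE)
  qed
  have "?M ^ K = real (card ?P)" by (simp add: card_PiE)
  also have "\<dots> = real (card (\<Union>i\<in>J. ?P \<inter> W i))"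
    using cover by (intro arg_cong[where f = "\<lambda>S. real (card S)"]) blast
  also have "\<dots> \<le> real (\<Sum>i\<in>J. card (?P \<inter> W i))"
    using card_UN_le[OF J] of_nat_mono by blast
  also have "\<dots> \<le> real (\<Sum>i\<in>J. card E ^ (K - k i))"
    by (intro of_nat_mono sum_mono card_piece)
  also have "\<dots> = (\<Sum>i\<in>J. ?M ^ K * (1 / ?M ^ k i))"
    unfolding of_nat_sum
  proof (rule sum.cong[OF refl])
    fix i assume "i \<in> J"
    then show "real (card E ^ (K - k i)) = ?M ^ K * (1 / ?M ^ k i)"
      using M kK power_diff[of ?M "k i" K] by simp
  qed
  finally have "?M ^ K * 1 \<le> ?M ^ K * (\<Sum>i\<in>J. 1 / ?M ^ k i)"
    by (simp add: sum_distrib_left)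
  then show ?thesis using M by (simp add: mult_le_cancel_left_pos)
qed

text \<open>The entropy of a set \<open>Z\<close> is bounded below as soon as a compact part \<open>F\<close> of \<open>Z\<close> realises every
  itinerary in the letters \<open>E\<close>, one letter per \<open>T\<close> time steps. Two points of a Bowen ball of order
  \<open>l\<close> and radius \<open>e\<close> are less than \<open>2 e\<close> apart; as the letters are \<open>4 e\<close>-separated and are shadowed
  up to \<open>e\<close>, the ball determines the first \<open>l div T\<close> letters. By compactness of \<open>F\<close> a cover may be taken
  to be finite, and then the Kraft inequality bounds its weight from below.\<close>

lemma bowen_entropy_ge_of_free_itineraries:
  fixes f :: "'a::metric_space \<Rightarrow> 'a"
  assumes cont: "continuous_on UNIV f" and F: "compact F" "F \<subseteq> Z"
    and E: "finite E" "E \<noteq> {}" "dyn_separated f n (4 * e) E"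
    and nT: "n \<le> T" "0 < T"
    and shadow: "\<And>w. (\<And>k. w k \<in> E) \<Longrightarrow>
      \<exists>x\<in>F. \<forall>k. \<forall>p\<le>n - 1. dist ((f ^^ (p + k * T)) x) ((f ^^ p) (w k)) \<le> e"
    and lam: "0 \<le> lam" "exp (lam * real T) \<le> real (card E)"
  shows "ereal lam \<le> bowen_entropy f Z e"
proof -
  let ?M = "real (card E)"
  have M: "0 < ?M" using E by (simp add: card_gt_0_iff)
  have pre: "ennreal (exp (- lam * real T)) \<le> bowen_premeasure f Z mu 0 e" if mu: "mu \<le> lam" for mu
    unfolding bowen_premeasure_def
  proof (rule Inf_greatest, clarify)
    fix I :: "nat set" and l :: "nat \<Rightarrow> nat" and x :: "nat \<Rightarrow> 'a"
    assume cover: "Z \<subseteq> (\<Union>i\<in>I. bowen_ball f (l i) (x i) e)"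
    obtain J where J: "J \<subseteq> I" "finite J" "F \<subseteq> (\<Union>i\<in>J. bowen_ball f (l i) (x i) e)"
      by (rule compactE_image[OF F(1) open_bowen_ball[OF cont] order_trans[OF F(2) cover]])
    define k where "k i = l i div T" for i
    define K where "K = (\<Sum>i\<in>J. k i)"
    let ?P = "PiE {..<K} (\<lambda>_. E)"
    have "\<exists>y\<in>F. \<forall>k<K. \<forall>p\<le>n - 1. dist ((f ^^ (p + k * T)) y) ((f ^^ p) (u k)) \<le> e" if u: "u \<in> ?P" for u
    proof -
      \<comment> \<open>A finite word is continued by an arbitrary letter.\<close>
      obtain a where "a \<in> E" using E(2) by blast
      then have "(if k < K then u k else a) \<in> E" for k using u by auto
      from shadow[of "\<lambda>k. if k < K then u k else a", OF this]
      obtain y where y: "y \<in> F" "\<And>k p. p \<le> n - 1 \<Longrightarrow>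
          dist ((f ^^ (p + k * T)) y) ((f ^^ p) (if k < K then u k else a)) \<le> e"
        by blast
      show ?thesis
      proof (intro bexI[OF _ y(1)] allI impI)
        fix k p assume "k < K" "p \<le> n - 1"
        then show "dist ((f ^^ (p + k * T)) y) ((f ^^ p) (u k)) \<le> e" using y(2)[of p k] by simp
      qed
    qed
    then obtain pt where pt: "\<And>u. u \<in> ?P \<Longrightarrow> pt u \<in> F"
      "\<And>u k p. u \<in> ?P \<Longrightarrow> k < K \<Longrightarrow> p \<le> n - 1 \<Longrightarrow>
        dist ((f ^^ (p + k * T)) (pt u)) ((f ^^ p) (u k)) \<le> e"
      by metis
    have "1 \<le> (\<Sum>i\<in>J. 1 / ?M ^ k i)"
    proof (rule cylinder_cover_weight_ge_1[where K = K and W = "\<lambda>i. {u. pt u \<in> bowen_ball f (l i) (x i) e}"])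
      show kK: "k i \<le> K" if "i \<in> J" for i
        unfolding K_def using J(2) that by (intro member_le_sum) auto
      show "?P \<subseteq> (\<Union>i\<in>J. {u. pt u \<in> bowen_ball f (l i) (x i) e})"
        using pt(1) J(3) by blast
      fix i u v q
      assume i: "i \<in> J" and u: "u \<in> {u. pt u \<in> bowen_ball f (l i) (x i) e}" "u \<in> ?P"
        and v: "v \<in> {u. pt u \<in> bowen_ball f (l i) (x i) e}" "v \<in> ?P" and q: "q < k i"
      have qK: "q < K" using q kK[OF i] by simp
      show "u q = v q"
      proof (rule ccontr)
        assume "u q \<noteq> v q"
        moreover have "u q \<in> E" "v q \<in> E" using u v qK by auto
        ultimately have "4 * e < bowen_dist f n (u q) (v q)"
          using E(3) by (simp add: dyn_separated_def)
        then obtain p where p: "p \<le> n - 1" "4 * e < dist ((f ^^ p) (u q)) ((f ^^ p) (v q))"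
          unfolding less_bowen_dist_iff by blast
        have "Suc q * T \<le> k i * T" using q by (intro mult_right_mono) auto
        also have "\<dots> \<le> l i" by (simp add: k_def)
        finally have "p + q * T \<le> l i - 1" using p(1) nT by simp
        then have "dist ((f ^^ (p + q * T)) (x i)) ((f ^^ (p + q * T)) (pt u)) < e"
          "dist ((f ^^ (p + q * T)) (x i)) ((f ^^ (p + q * T)) (pt v)) < e"
          using u(1) v(1) by (auto simp: bowen_ball_def bowen_dist_less_iff)
        moreover have "dist ((f ^^ (p + q * T)) (pt u)) ((f ^^ p) (u q)) \<le> e"
          "dist ((f ^^ (p + q * T)) (pt v)) ((f ^^ p) (v q)) \<le> e"
          using pt(2) u(2) v(2) qK p(1) by auto
        ultimately show False
          using p(2) dist_triangle3[of "(f ^^ p) (u q)" "(f ^^ p) (v q)" "(f ^^ (p + q * T)) (pt u)"]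
            dist_triangle[of "(f ^^ (p + q * T)) (pt u)" "(f ^^ p) (v q)" "(f ^^ (p + q * T)) (pt v)"]
            dist_triangle3[of "(f ^^ (p + q * T)) (pt u)" "(f ^^ (p + q * T)) (pt v)" "(f ^^ (p + q * T)) (x i)"]
          by linarith
      qed
    qed (use E J in auto)
    then have "exp (- lam * real T) * 1 \<le> exp (- lam * real T) * (\<Sum>i\<in>J. 1 / ?M ^ k i)"
      by (rule mult_left_mono) simp
    then have "exp (- lam * real T) \<le> (\<Sum>i\<in>J. exp (- lam * real T) * (1 / ?M ^ k i))"
      by (simp only: sum_distrib_left mult_1_right)
    also have "\<dots> \<le> (\<Sum>i\<in>J. exp (- mu * real (l i)))"
    proof (rule sum_mono)
      fix i
      have "l i \<le> T + k i * T"
        using nT(2) mod_less_divisor[of T "l i"] div_mult_mod_eq[of "l i" T] unfolding k_def by linarith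
      then have "real (l i) \<le> real T + real (k i) * real T"
        by (metis of_nat_add of_nat_le_iff of_nat_mult)
      then have "lam * real (l i) \<le> lam * (real T + real (k i) * real T)"
        using lam(1) by (rule mult_left_mono)
      moreover have "mu * real (l i) \<le> lam * real (l i)"
        using mu by (intro mult_right_mono) auto
      ultimately have "exp (- lam * real T - real (k i) * (lam * real T)) \<le> exp (- mu * real (l i))"
        by (simp add: algebra_simps)
      moreover have "exp (real (k i) * (lam * real T)) \<le> ?M ^ k i"
        unfolding exp_of_nat_mult using lam(2) by (intro power_mono) auto
      then have "1 / ?M ^ k i \<le> 1 / exp (real (k i) * (lam * real T))"
        using M by (intro divide_left_mono) auto
      then have "exp (- lam * real T) * (1 / ?M ^ k i) \<le> exp (- lam * real T - real (k i) * (lam * real T))"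
        using mult_left_mono[of _ _ "exp (- lam * real T)"] by (simp add: exp_diff divide_inverse)
      ultimately show "exp (- lam * real T) * (1 / ?M ^ k i) \<le> exp (- mu * real (l i))" by linarith
    qed
    finally have "ennreal (exp (- lam * real T)) \<le> (\<Sum>i\<in>J. ennreal (exp (- mu * real (l i))))"
      by (simp add: ennreal_leI)
    also have "\<dots> \<le> (\<Sum>\<^sub>\<infinity>i\<in>I. ennreal (exp (- mu * real (l i))))"
      using J by (subst nonneg_infsum_complete) (auto intro!: SUP_upper)
    finally show "ennreal (exp (- lam * real T)) \<le> (\<Sum>\<^sub>\<infinity>i\<in>I. ennreal (exp (- mu * real (l i))))" .
  qed
  have "lam \<le> mu" if "bowen_measure f Z mu e = 0" for mu
  proof (rule ccontr)
    assume "\<not> lam \<le> mu"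
    then have "ennreal (exp (- lam * real T)) \<le> bowen_premeasure f Z mu 0 e"
      by (intro pre) simp
    also have "\<dots> \<le> bowen_measure f Z mu e"
      unfolding bowen_measure_eq_SUP by (rule SUP_upper) simp
    finally show False using that by simp
  qed
  then show ?thesis
    unfolding bowen_entropy_def by (intro Inf_greatest) auto
qed

section \<open>Consequences of specification\<close>

text \<open>Specification extends from finitely many to infinitely many orbit segments: by continuity the
  points that shadow one given segment with error at most \<open>e\<close> form a closed set, and these closed
  sets have the finite intersection property. The strict error bound is thereby lost.\<close>

lemma infinite_specification:
  fixes f :: "'a::metric_space \<Rightarrow> 'a"
  assumes "compact (UNIV::'a set)" and cont: "continuous_on UNIV f"
    and "specification_property f" and "0 < e"
  obtains m :: nat where "1 \<le> m"
    "\<And>a b xs. \<lbrakk>\<And>j::nat. a j \<le> b j; \<And>j. b j + m \<le> a (Suc j)\<rbrakk> \<Longrightarrow>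
      \<exists>x. \<forall>j. \<forall>p\<le>b j - a j. dist ((f ^^ (p + a j)) x) ((f ^^ p) (xs j)) \<le> e"
proof -
  obtain m0 :: int where m0: "\<forall>(k::nat) (a::nat \<Rightarrow> nat) (b::nat \<Rightarrow> nat) (xs::nat \<Rightarrow> 'a).
      (\<forall>j\<in>{1..k}. a j \<le> b j) \<longrightarrow> (\<forall>j\<in>{1..<k}. int (a (j + 1)) - int (b j) \<ge> m0) \<longrightarrow>
      (\<exists>x. \<forall>j\<in>{1..k}. \<forall>p\<in>{0..b j - a j}. dist ((f ^^ (p + a j)) x) ((f ^^ p) (xs j)) < e)"
    using assms(3)[unfolded specification_property_def, THEN spec, THEN mp, OF assms(4)] by (elim exE)
  \<comment> \<open>The gap \<open>m0\<close> may be negative; a larger gap has the same property.\<close>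
  define m where "m = nat (max m0 1)"
  show ?thesis
  proof (rule that[of m])
    show "1 \<le> m" by (simp add: m_def)
    fix a b :: "nat \<Rightarrow> nat" and xs :: "nat \<Rightarrow> 'a"
    assume ab: "\<And>j. a j \<le> b j" and gap: "\<And>j. b j + m \<le> a (Suc j)"
    define C where "C j = (\<Inter>p\<in>{..b j - a j}. {x. dist ((f ^^ (p + a j)) x) ((f ^^ p) (xs j)) \<le> e})" for j
    have "UNIV \<inter> (\<Inter>j\<in>UNIV. C j) \<noteq> {}"
    proof (rule compact_imp_fip_image[OF assms(1)])
      show "closed (C j)" for j
        unfolding C_def by (intro closed_INT ballI closed_shadowing[OF cont])
      fix I :: "nat set" assume "finite I"
      then obtain k where k: "\<And>j. j \<in> I \<Longrightarrow> j < k"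
        using finite_nat_set_iff_bounded by auto
      \<comment> \<open>In the specification property the segments are numbered from \<open>1\<close>.\<close>
      have "\<exists>x. \<forall>j\<in>{1..k}. \<forall>p\<in>{0..b (j - 1) - a (j - 1)}.
          dist ((f ^^ (p + a (j - 1))) x) ((f ^^ p) (xs (j - 1))) < e"
      proof (rule m0[THEN spec[of _ k], THEN spec[of _ "\<lambda>j. a (j - 1)"],
            THEN spec[of _ "\<lambda>j. b (j - 1)"], THEN spec[of _ "\<lambda>j. xs (j - 1)"], THEN mp, THEN mp])
        show "\<forall>j\<in>{1..<k}. m0 \<le> int (a (j + 1 - 1)) - int (b (j - 1))"
        proof
          fix j assume "j \<in> {1..<k}"
          then have "b (j - 1) + m \<le> a j" using gap[of "j - 1"] by simp
          then show "m0 \<le> int (a (j + 1 - 1)) - int (b (j - 1))" unfolding m_def by simp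
        qed
      qed (use ab in auto)
      then obtain x where x: "\<forall>j\<in>{1..k}. \<forall>p\<in>{0..b (j - 1) - a (j - 1)}.
          dist ((f ^^ (p + a (j - 1))) x) ((f ^^ p) (xs (j - 1))) < e"
        by (elim exE)
      have "x \<in> C j" if "j \<in> I" for j
        unfolding C_def using bspec[OF x, of "Suc j"] k[OF that] by (auto intro: less_imp_le)
      then show "UNIV \<inter> (\<Inter>j\<in>I. C j) \<noteq> {}" by blast
    qed
    then show "\<exists>x. \<forall>j. \<forall>p\<le>b j - a j. dist ((f ^^ (p + a j)) x) ((f ^^ p) (xs j)) \<le> e"
      unfolding C_def by blast
  qed
qed

text \<open>If the orbit of \<open>z0\<close> avoids a ball that the orbit of \<open>x\<close> enters (well inside) with bounded
  gaps, then the orbit of \<open>x\<close> cannot come close to \<open>z0\<close>: it would follow the orbit of \<open>z0\<close> for too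
  long and miss the ball.\<close>

lemma nonaccumulating_if_syndetic_visits:
  fixes f :: "'a::metric_space \<Rightarrow> 'a"
  assumes cont: "continuous_on UNIV f" and "0 < r"
    and avoid: "\<And>i. r \<le> dist ((f ^^ i) z0) c"
    and visits: "\<And>q. \<exists>i\<le>L. dist ((f ^^ (q + i)) x) c \<le> r / 2"
  shows "x \<in> nonaccumulating_set f z0"
proof -
  define U where "U = (\<Inter>i\<in>{..L}. {y. dist ((f ^^ i) y) ((f ^^ i) z0) < r / 2})"
  have "open U"
    unfolding U_def
    by (intro open_INT ballI finite_atMost open_Collect_less continuous_intros
        continuous_on_funpow[OF cont])
  moreover have "z0 \<in> U" using assms(2) by (simp add: U_def)
  moreover have "U \<inter> forward_orbit f x = {}"
  proof (rule ccontr)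
    assume "U \<inter> forward_orbit f x \<noteq> {}"
    then obtain q where q: "(f ^^ q) x \<in> U" by (auto simp: forward_orbit_def)
    obtain i where i: "i \<le> L" "dist ((f ^^ (q + i)) x) c \<le> r / 2" using visits by blast
    have "dist ((f ^^ (q + i)) x) ((f ^^ i) z0) < r / 2"
      using q i(1) by (auto simp: U_def funpow_add add.commute[of q])
    then show False
      using i(2) avoid[of i] dist_triangle3[of "(f ^^ i) z0" c "(f ^^ (q + i)) x"] by linarith
  qed
  ultimately have "z0 \<notin> closure (forward_orbit f x)"
    by (meson closure_iff_nhds_not_empty inf_commute order_refl disjoint_iff IntI)
  then show ?thesis by (simp add: nonaccumulating_set_def)
qed

text \<open>Freely chosen letters, each followed by a visit to the centre \<open>c\<close> of a ball that the orbit of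
  \<open>z0\<close> avoids. The price is a gap whose length depends only on the shadowing accuracy, not on \<open>n\<close>,
  so that the entropy per time step is almost that of the letters.\<close>

lemma separated_growth_le_bowen_entropy:
  fixes f :: "'a::metric_space \<Rightarrow> 'a"
  assumes comp: "compact (UNIV::'a set)" and cont: "continuous_on UNIV f"
    and spec: "specification_property f"
    and trans: "closure (forward_orbit f z0) \<noteq> UNIV" and e: "0 < e"
  shows "separated_growth f UNIV (4 * e) \<le> bowen_entropy f (nonaccumulating_set f z0) e"
proof -
  let ?Z = "nonaccumulating_set f z0"
  obtain c where "c \<notin> closure (forward_orbit f z0)" using trans by blast
  then obtain r where r: "0 < r" "\<And>y. y \<in> forward_orbit f z0 \<Longrightarrow> r \<le> dist y c"
    by (force simp: closure_approachable not_less)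
  \<comment> \<open>Accuracy \<open>e\<close> separates the itineraries, accuracy \<open>r / 2\<close> makes the visits count.\<close>
  define e' where "e' = min e (r / 2)"
  have e': "0 < e'" "e' \<le> e" "e' \<le> r / 2" using e r(1) by (auto simp: e'_def)
  obtain m :: nat where m: "1 \<le> m"
    "\<And>a b xs. \<lbrakk>\<And>j::nat. a j \<le> b j; \<And>j. b j + m \<le> a (Suc j)\<rbrakk> \<Longrightarrow>
      \<exists>x. \<forall>j. \<forall>p\<le>b j - a j. dist ((f ^^ (p + a j)) x) ((f ^^ p) (xs j)) \<le> e'"
    using infinite_specification[OF comp cont spec e'(1)] by metis
  have entropy_ge: "ereal lam \<le> bowen_entropy f ?Z e"
    if n: "1 \<le> n" and lam: "0 \<le> lam"
      "lam * real (n - 1 + 2 * m) \<le> ln (real (max_separated f UNIV n (4 * e)))" for n lam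
  proof -
    define s T where "s = n - 1 + m" and "T = n - 1 + 2 * m"
    have T: "n \<le> T" "0 < T" "s \<le> T" using n m(1) by (auto simp: s_def T_def)
    obtain E where E: "finite E" "E \<noteq> {}" "dyn_separated f n (4 * e) E"
      "card E = max_separated f UNIV n (4 * e)"
      using max_separated_spanning[OF comp cont, of "4 * e" n] e by (metis mult_pos_pos zero_less_numeral)
    define F where "F = (\<Inter>k. (\<Union>w\<in>E. \<Inter>p\<in>{..n - 1}. {x. dist ((f ^^ (p + k * T)) x) ((f ^^ p) w) \<le> e'})
      \<inter> {x. dist ((f ^^ (k * T + s)) x) c \<le> e'})"
    have "closed F"
      unfolding F_def using E(1)
      by (intro closed_INT closed_Int closed_UN ballI closed_shadowing[OF cont]) auto
    then have "compact F" using comp compact_Int_closed by (metis inf_top_left)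
    moreover have "F \<subseteq> ?Z"
    proof
      fix x assume x: "x \<in> F"
      show "x \<in> ?Z"
      proof (rule nonaccumulating_if_syndetic_visits[OF cont r(1)])
        show "r \<le> dist ((f ^^ i) z0) c" for i
          by (rule r(2)) (auto simp: forward_orbit_def)
        fix q
        \<comment> \<open>The visit in the period after the current one comes after at most \<open>2 * T\<close> steps.\<close>
        have "q mod T < T" using T(2) by simp
        moreover have "Suc (q div T) * T = q div T * T + T" by simp
        ultimately have "q \<le> Suc (q div T) * T + s" "Suc (q div T) * T + s \<le> q + 2 * T"
          using T(3) div_mult_mod_eq[of q T] by linarith+
        then obtain i where i: "Suc (q div T) * T + s = q + i" "i \<le> 2 * T"
          by (metis add_le_cancel_left le_iff_add)
        have "dist ((f ^^ (Suc (q div T) * T + s)) x) c \<le> e'"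
          using x unfolding F_def by blast
        then show "\<exists>i\<le>2 * T. dist ((f ^^ (q + i)) x) c \<le> r / 2"
          using i e'(3) by (metis order_trans)
      qed
    qed
    moreover have "\<exists>x\<in>F. \<forall>k. \<forall>p\<le>n - 1. dist ((f ^^ (p + k * T)) x) ((f ^^ p) (w k)) \<le> e"
      if w: "\<And>k. w k \<in> E" for w
    proof -
      \<comment> \<open>Even segments are the letters, odd segments the visits to \<open>c\<close>.\<close>
      define a where "a j = (j div 2) * T + (if even j then 0 else s)" for j
      define b where "b j = (if even j then a j + (n - 1) else a j)" for j
      have "\<exists>x. \<forall>j. \<forall>p\<le>b j - a j. dist ((f ^^ (p + a j)) x)
          ((f ^^ p) (if even j then w (j div 2) else c)) \<le> e'"
      proof (rule m(2)[of a b "\<lambda>j. if even j then w (j div 2) else c"])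
        show "b j + m \<le> a (Suc j)" for j
          by (cases "even j") (auto simp: a_def b_def s_def T_def elim!: evenE oddE)
      qed (simp add: b_def)
      then obtain x where x: "\<And>j p. p \<le> b j - a j \<Longrightarrow>
          dist ((f ^^ (p + a j)) x) ((f ^^ p) (if even j then w (j div 2) else c)) \<le> e'"
        by blast
      have letter: "dist ((f ^^ (p + k * T)) x) ((f ^^ p) (w k)) \<le> e'" if "p \<le> n - 1" for k p
        using x[of p "2 * k"] that by (simp add: a_def b_def)
      moreover have "dist ((f ^^ (k * T + s)) x) c \<le> e'" for k
        using x[of 0 "2 * k + 1"] by (simp add: a_def b_def)
      ultimately have "x \<in> F" unfolding F_def using w by blast
      then show ?thesis using letter e'(2) order_trans by blast
    qed
    moreover have "exp (lam * real T) \<le> real (card E)"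
      using lam(2) E unfolding T_def
      by (metis card_gt_0_iff exp_le_cancel_iff exp_ln of_nat_0_less_iff)
    ultimately show ?thesis
      using E T lam(1) by (intro bowen_entropy_ge_of_free_itineraries[OF cont, of F ?Z E n e T lam]) auto
  qed
  \<comment> \<open>The bound with rate \<open>0\<close>; it makes the rates positive that are compared below.\<close>
  have nonneg: "0 \<le> bowen_entropy f ?Z e"
  proof -
    obtain E :: "'a set" where "finite E" "E \<noteq> {}" "card E = max_separated f UNIV 1 (4 * e)"
      using max_separated_spanning[OF comp cont, of "4 * e" 1] e by (metis mult_pos_pos zero_less_numeral)
    then have "1 \<le> real (max_separated f UNIV 1 (4 * e))"
      by (metis One_nat_def Suc_leI card_gt_0_iff of_nat_1 of_nat_mono)
    then have "ereal 0 \<le> bowen_entropy f ?Z e" by (intro entropy_ge[of 1]) auto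
    then show ?thesis by (simp add: zero_ereal_def)
  qed
  show "separated_growth f UNIV (4 * e) \<le> bowen_entropy f ?Z e"
  proof (rule ccontr)
    assume "\<not> ?thesis"
    then obtain lam where lam: "bowen_entropy f ?Z e < ereal lam" "ereal lam < separated_growth f UNIV (4 * e)"
      using ereal_dense2 by (force simp: not_le)
    obtain mu where mu: "lam < mu" "ereal mu < separated_growth f UNIV (4 * e)"
      using ereal_dense2[OF lam(2)] by auto
    have "0 < ereal lam" using nonneg lam(1) by (rule le_less_trans)
    then have lam0: "0 < lam" by simp
    \<comment> \<open>For \<open>n \<ge> N\<close> the surplus \<open>(mu - lam) n\<close> pays for the gaps of total length \<open>2 m\<close>.\<close>
    obtain N :: nat where N: "lam * (2 * real m) / (mu - lam) \<le> real N" using real_arch_simple by blast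
    have "\<not> eventually (\<lambda>n. ereal (1 / real n * ln (real (max_separated f UNIV n (4 * e)))) \<le> ereal mu) sequentially"
    proof
      assume "eventually (\<lambda>n. ereal (1 / real n * ln (real (max_separated f UNIV n (4 * e)))) \<le> ereal mu) sequentially"
      then have "separated_growth f UNIV (4 * e) \<le> ereal mu"
        unfolding separated_growth_def by (rule Limsup_bounded)
      then show False using mu(2) by simp
    qed
    then obtain n where n: "max N 1 \<le> n" "ereal mu < ereal (1 / real n * ln (real (max_separated f UNIV n (4 * e))))"
      unfolding eventually_sequentially not_all not_ex not_imp not_le by blast
    have "lam * (2 * real m) \<le> (mu - lam) * real N"
      using N mu(1) by (simp add: field_simps)
    also have "\<dots> \<le> (mu - lam) * real n" using n(1) mu(1) by (intro mult_left_mono) auto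
    finally have "lam * (real n + 2 * real m) \<le> mu * real n" by (simp add: algebra_simps)
    moreover have "mu * real n \<le> ln (real (max_separated f UNIV n (4 * e)))"
      using n by (simp add: field_simps)
    moreover have "lam * real (n - 1 + 2 * m) \<le> lam * (real n + 2 * real m)"
      using lam0 by (intro mult_left_mono) auto
    ultimately have "lam * real (n - 1 + 2 * m) \<le> ln (real (max_separated f UNIV n (4 * e)))"
      by linarith
    then have "ereal lam \<le> bowen_entropy f ?Z e"
      using n(1) lam0 by (intro entropy_ge[of n]) simp_all
    then show False using lam(1) by simp
  qed
qed

section \<open>Rescaling the resolution\<close>

lemma Limsup_Liminf_mono_asymp:
  fixes u v :: "'b \<Rightarrow> ereal"
  assumes le: "eventually (\<lambda>x. u x \<le> ereal (r x) * v x) F"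
    and r: "(r \<longlongrightarrow> 1) F"
  shows "Limsup F u \<le> Limsup F v" and "Liminf F u \<le> Liminf F v"
proof -
  have rpos: "eventually (\<lambda>x. 0 < r x) F"
    using order_tendstoD(1)[OF r, of 0] by simp
  have upper: "eventually (\<lambda>x. ereal (r x) * a < ereal b) F" if "a < b" for a b :: real
    using order_tendstoD(2)[OF tendsto_mult_right[OF r, of a], of b] that by simp
  show "Limsup F u \<le> Limsup F v"
    unfolding Limsup_le_iff
  proof (intro allI impI)
    fix y assume "Limsup F v < y"
    then obtain b where b: "Limsup F v < ereal b" "ereal b < y" using ereal_dense2 by blast
    then obtain a where a: "Limsup F v < ereal a" "a < b" using ereal_dense2[OF b(1)] by auto
    show "eventually (\<lambda>x. u x < y) F"
      using le rpos upper[OF a(2)] Limsup_lessD[OF a(1)]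
    proof eventually_elim
      case (elim x)
      have "ereal (r x) * v x \<le> ereal (r x) * ereal a"
        using elim by (intro ereal_mult_left_mono) auto
      then show ?case using elim b(2) by (meson le_less_trans less_trans)
    qed
  qed
  show "Liminf F u \<le> Liminf F v"
    unfolding le_Liminf_iff
  proof (intro allI impI)
    fix y assume "y < Liminf F u"
    then obtain a where a: "y < ereal a" "ereal a < Liminf F u" using ereal_dense2 by blast
    then obtain b where b: "a < b" "ereal b < Liminf F u" using ereal_dense2[OF a(2)] by auto
    show "eventually (\<lambda>x. y < v x) F"
      using le rpos upper[OF b(1)] less_LiminfD[OF b(2)]
    proof eventually_elim
      case (elim x)
      have "\<not> v x \<le> ereal a"
      proof
        assume "v x \<le> ereal a"
        then have "ereal (r x) * v x \<le> ereal (r x) * ereal a"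
          using elim by (intro ereal_mult_left_mono) auto
        then show False using elim by (meson le_less_trans less_trans not_less order_trans less_irrefl)
      qed
      then show ?case using a(1) by auto
    qed
  qed
qed

lemma Limsup_Liminf_at_right_0_rescale:
  fixes g :: "real \<Rightarrow> ereal"
  assumes "0 < c"
  shows "Limsup (at_right 0) (\<lambda>x. g (c * x)) = Limsup (at_right 0) g"
    and "Liminf (at_right 0) (\<lambda>x. g (c * x)) = Liminf (at_right 0) g"
proof -
  have inj: "inj ((*) c)" using assms by (simp add: inj_on_def)
  have "filtermap ((*) c) (at_right 0) = at_right 0"
    using filtermap_times_pos_at_right[OF assms, of 0] by simp
  then show "Limsup (at_right 0) (\<lambda>x. g (c * x)) = Limsup (at_right 0) g"
    "Liminf (at_right 0) (\<lambda>x. g (c * x)) = Liminf (at_right 0) g"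
    using Limsup_filtermap_eq[OF inj, of "at_right 0" g] Liminf_filtermap_eq[OF inj, of "at_right 0" g]
    by simp_all
qed

lemma log_scale_ratio_tendsto_1:
  fixes a b :: real
  assumes "0 < a" "0 < b"
  shows "((\<lambda>x. \<bar>ln (a * x)\<bar> / \<bar>ln (b * x)\<bar>) \<longlongrightarrow> 1) (at_right 0)"
  using assms by real_asymp

text \<open>Inequalities between two quantities at proportional resolutions pass to the metric mean
  dimensions, as \<open>\<bar>ln (a * x)\<bar>\<close> and \<open>\<bar>ln (b * x)\<bar>\<close> are asymptotically equal.\<close>

lemma log_rate_mono_rescale:
  fixes g h :: "real \<Rightarrow> ereal"
  assumes "0 < a" "0 < b" and le: "\<And>x. 0 < x \<Longrightarrow> g (a * x) \<le> h (b * x)"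
  shows "Limsup (at_right 0) (\<lambda>x. g x / ereal \<bar>ln x\<bar>) \<le> Limsup (at_right 0) (\<lambda>x. h x / ereal \<bar>ln x\<bar>)"
    and "Liminf (at_right 0) (\<lambda>x. g x / ereal \<bar>ln x\<bar>) \<le> Liminf (at_right 0) (\<lambda>x. h x / ereal \<bar>ln x\<bar>)"
proof -
  let ?u = "\<lambda>x. g (a * x) / ereal \<bar>ln (a * x)\<bar>" and ?v = "\<lambda>x. h (b * x) / ereal \<bar>ln (b * x)\<bar>"
  have pos: "eventually (\<lambda>x. 0 < x \<and> 0 < \<bar>ln (a * x)\<bar> \<and> 0 < \<bar>ln (b * x)\<bar>) (at_right 0)"
  proof -
    have "filterlim (\<lambda>x. \<bar>ln (a * x)\<bar>) at_top (at_right 0)" "filterlim (\<lambda>x. \<bar>ln (b * x)\<bar>) at_top (at_right 0)"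
      using assms(1,2) by real_asymp+
    then have "eventually (\<lambda>x. 0 < \<bar>ln (a * x)\<bar>) (at_right 0)" "eventually (\<lambda>x. 0 < \<bar>ln (b * x)\<bar>) (at_right 0)"
      unfolding filterlim_at_top_dense by blast+
    then show ?thesis by (intro eventually_conj eventually_at_right_less)
  qed
  have "eventually (\<lambda>x. ?u x \<le> ereal (\<bar>ln (b * x)\<bar> / \<bar>ln (a * x)\<bar>) * ?v x) (at_right 0)"
    using pos
  proof eventually_elim
    case (elim x)
    have "?u x \<le> h (b * x) / ereal \<bar>ln (a * x)\<bar>"
      using elim le[of x] by (intro ereal_divide_right_mono) auto
    also have "\<dots> = ereal (\<bar>ln (b * x)\<bar> / \<bar>ln (a * x)\<bar>) * ?v x"
      using elim by (cases "h (b * x)") auto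
    finally show ?case .
  qed
  note mono = Limsup_Liminf_mono_asymp[OF this log_scale_ratio_tendsto_1[OF assms(2,1)]]
  show "Limsup (at_right 0) (\<lambda>x. g x / ereal \<bar>ln x\<bar>) \<le> Limsup (at_right 0) (\<lambda>x. h x / ereal \<bar>ln x\<bar>)"
    using mono(1) Limsup_Liminf_at_right_0_rescale(1)[OF assms(1), of "\<lambda>x. g x / ereal \<bar>ln x\<bar>"]
      Limsup_Liminf_at_right_0_rescale(1)[OF assms(2), of "\<lambda>x. h x / ereal \<bar>ln x\<bar>"] by simp
  show "Liminf (at_right 0) (\<lambda>x. g x / ereal \<bar>ln x\<bar>) \<le> Liminf (at_right 0) (\<lambda>x. h x / ereal \<bar>ln x\<bar>)"
    using mono(2) Limsup_Liminf_at_right_0_rescale(2)[OF assms(1), of "\<lambda>x. g x / ereal \<bar>ln x\<bar>"]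
      Limsup_Liminf_at_right_0_rescale(2)[OF assms(2), of "\<lambda>x. h x / ereal \<bar>ln x\<bar>"] by simp
qed

section \<open>Metric mean dimension of the non-accumulating set\<close>

theorem theorem1p1:
  fixes f :: "'a::metric_space \<Rightarrow> 'a" and z0 :: 'a
  assumes "compact (UNIV::'a set)"
    and "continuous_on UNIV f"
    and "specification_property f"
    and "closure (forward_orbit f z0) \<noteq> UNIV"
  shows "nonaccumulating_set f z0 = {} \<or>
    (upper_bowen_mdim f (nonaccumulating_set f z0) = upper_mdim f UNIV \<and>
     lower_bowen_mdim f (nonaccumulating_set f z0) = lower_mdim f UNIV)"
proof -
  let ?h = "bowen_entropy f (nonaccumulating_set f z0)" and ?g = "separated_growth f UNIV"
  have upper: "?h (1 * x) \<le> ?g (1/2 * x)" if "0 < x" for x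
    using bowen_entropy_le_separated_growth[OF assms(1,2), of "x/2" x] that by simp
  have lower: "?g (4 * x) \<le> ?h (1 * x)" if "0 < x" for x
    using separated_growth_le_bowen_entropy[OF assms that] by simp
  note le = log_rate_mono_rescale[of 1 "1/2" ?h ?g, OF _ _ upper]
  note ge = log_rate_mono_rescale[of 4 1 ?g ?h, OF _ _ lower]
  show ?thesis
    unfolding upper_bowen_mdim_def lower_bowen_mdim_def upper_mdim_def lower_mdim_def
    by (intro disjI2 conjI antisym le ge) simp_all
qed

end
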